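(* Let $(X,\mu)$ be a probability space, let $N \geq 2$ and $n \geq 1$ be integers, and let $Z = (Z_1,\ldots,Z_n)$ be an $n$-tuple of random points of $X$ (defined on a common probability space) such that for every $i \in \{1,\ldots,n\}$ the law of $Z_i$ is $\mu$. The $Z_i$ are not assumed to be independent. Assume moreover that $X$ can be partitioned into $N$ measurable subsets of equal measure. Then $$\sup_{\substack{f \in L^2(X,\mu) \\ \Vert f \Vert_2 = 1}} \operatorname{Var}\left(\frac{1}{n}\sum_{i=1}^n f(Z_i) - \int_X f \, d\mu\right) \geq \frac{1}{n}\left(1 - \frac{n-1}{N-1}\right).$$
   Context: A random point of $X$ is an $X$-valued random variable, i.e. a measurable map from some probability space $(\Omega,\mathbb{P})$ to $X$; its law is the push-forward of $\mathbb{P}$ under this map. $L^2(X,\mu)$ is the space of square-integrable (real- or complex-valued) functions on $X$ with norm $\Vert f\Vert_2 = \left(\int_X |f|^2 \, d\mu\right)^{1/2}$. $\operatorname{Var}(Y) = \mathbb{E}\left[|Y - \mathbb{E}[Y]|^2\right]$ denotes the variance, taken with respect to $\mathbb{P}$. *)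

theory Defs
  imports "HOL-Probability.Probability"
begin

text \<open>
  The definitions are generic in the codomain, so that they apply to both real- and
  complex-valued functions. Elements of \<open>L\<^sup>2\<close> are represented by measurable functions rather than
  by classes modulo null sets; the norm, the integral, and (since each \<open>Z i\<close> has law \<open>M\<close>) the
  variance in question depend only on the class.
\<close>

definition L2_space :: "'a measure \<Rightarrow> ('a \<Rightarrow> 'b :: {banach, second_countable_topology}) set" where
  "L2_space M = {f \<in> borel_measurable M. integrable M (\<lambda>x. (norm (f x))\<^sup>2)}"

definition L2_norm :: "'a measure \<Rightarrow> ('a \<Rightarrow> 'b :: {banach, second_countable_topology}) \<Rightarrow> real" where
  "L2_norm M f = sqrt (\<integral>x. (norm (f x))\<^sup>2 \<partial>M)"

text \<open>
  The library's \<open>variance\<close> is restricted to real random variables, where it agrees with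
  the following.
\<close>

definition Var :: "'w measure \<Rightarrow> ('w \<Rightarrow> 'b :: {banach, second_countable_topology}) \<Rightarrow> real" where
  "Var P Y = (\<integral>w. (norm (Y w - (\<integral>w'. Y w' \<partial>P)))\<^sup>2 \<partial>P)"

end

theory Submission
  imports Defs
begin

text \<open>
  The supremum is at least the average of the variance over any family of normalised test
  functions, and centred indicators of the \<open>N\<close> parts are a family for which this average can be
  controlled. Let \<open>T\<^sub>A\<close> be the number of indices \<open>i\<close> with \<open>Z\<^sub>i \<in> A\<close>. Every
  empirical mean is unbiased, so for the function \<open>1\<^sub>A - 1/N\<close>, whose squared norm is
  \<open>(N - 1)/N\<^sup>2\<close>, the variance is the expectation of \<open>(T\<^sub>A - n/N)\<^sup>2/n\<^sup>2\<close>. The sum of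
  \<open>(T\<^sub>A - n/N)\<^sup>2\<close> over the parts is bounded below at every sample point, whatever the dependence
  between the points: the \<open>T\<^sub>A\<close> add up to \<open>n\<close>, and \<open>T\<^sub>A\<^sup>2 \<ge> T\<^sub>A\<close> because they are
  natural numbers, so the sum is at least \<open>n - n\<^sup>2/N\<close> (lemma \<open>sum_counts_deviation_ge\<close>). Hence the
  normalised functions have average variance at least
  \<open>(1/N) (N\<^sup>2/(N - 1)) (n - n\<^sup>2/N)/n\<^sup>2 = (N - n)/(n (N - 1))\<close>, which is the claimed bound, and
  the function of some part does at least as well. The function found is real-valued; it serves for both scalar fields.
\<close>

lemma (in prob_space) prob_part_equal:
  assumes "partition_on (space M) \<A>" "finite \<A>" "\<A> \<subseteq> events"
    and eq: "\<And>A B. A \<in> \<A> \<Longrightarrow> B \<in> \<A> \<Longrightarrow> prob A = prob B" and A: "A \<in> \<A>"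
  shows "prob A = 1 / card \<A>"
proof -
  have "prob (\<Union>B\<in>\<A>. B) = (\<Sum>B\<in>\<A>. prob B)"
    using assms by (intro finite_measure_finite_Union)
      (auto simp: partition_on_def disjoint_family_on_def disjoint_def)
  moreover have "(\<Union>B\<in>\<A>. B) = space M"
    using assms(1) by (auto simp: partition_on_def)
  moreover have "(\<Sum>B\<in>\<A>. prob B) = (\<Sum>B\<in>\<A>. prob A)"
    by (intro sum.cong refl eq A)
  ultimately have "card \<A> * prob A = 1"
    by (simp add: prob_space)
  then show ?thesis
    by (metis mult_zero_left nonzero_eq_divide_eq mult.commute zero_neq_one)
qed

text \<open>
  Expanding the square leaves the sum of the squared counts minus \<open>n\<^sup>2/N\<close>. The squared counts
  sum to at least \<open>n\<close>, with equality when no two points share a part.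
\<close>
lemma sum_counts_deviation_ge:
  fixes z :: "'i \<Rightarrow> 'a" and I :: "'i set" and \<A> :: "'a set set"
  defines "T \<equiv> \<lambda>A. \<Sum>i\<in>I. indicat_real A (z i)"
  assumes part: "partition_on S \<A>" and fin: "finite \<A>" "finite I" and ne: "\<A> \<noteq> {}"
    and z: "\<And>i. i \<in> I \<Longrightarrow> z i \<in> S"
  shows "(\<Sum>A\<in>\<A>. (T A - card I / card \<A>)\<^sup>2) \<ge> card I - (card I)\<^sup>2 / card \<A>"
proof -
  have one: "(\<Sum>A\<in>\<A>. indicat_real A (z i)) = 1" if i: "i \<in> I" for i
  proof -
    obtain B where B: "B \<in> \<A>" "z i \<in> B"
      using part z[OF i] by (auto simp: partition_on_def)
    have "indicat_real A (z i) = (if A = B then 1 else 0)" if "A \<in> \<A>" for A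
      using part B that by (auto simp: partition_on_def disjoint_def indicator_def)
    then show ?thesis
      using B fin by simp
  qed
  have total: "(\<Sum>A\<in>\<A>. T A) = card I"
    unfolding T_def by (subst sum.swap) (simp add: one)
  have "T A \<le> (T A)\<^sup>2" for A
  proof -
    have "T A = real (card {i\<in>I. z i \<in> A})"
      unfolding T_def indicator_def using fin by (simp add: sum.If_cases Int_def)
    then show ?thesis
      by (metis of_nat_le_iff of_nat_power power2_nat_le_imp_le power2_eq_square le_square)
  qed
  then have sq: "(\<Sum>A\<in>\<A>. (T A)\<^sup>2) \<ge> card I"
    using sum_mono[of \<A> T "\<lambda>A. (T A)\<^sup>2"] total by simp
  define t where "t = real (card I) / card \<A>"
  have N: "real (card \<A>) > 0"
    using fin ne by (simp add: card_gt_0_iff)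
  have "(\<Sum>A\<in>\<A>. (T A - t)\<^sup>2) = (\<Sum>A\<in>\<A>. (T A)\<^sup>2 - 2 * t * T A + t\<^sup>2)"
    by (intro sum.cong refl) (simp add: power2_eq_square algebra_simps)
  also have "\<dots> = (\<Sum>A\<in>\<A>. (T A)\<^sup>2) - 2 * t * card I + card \<A> * t\<^sup>2"
    by (simp add: sum.distrib sum_subtractf total flip: sum_distrib_left)
  also have "\<dots> = (\<Sum>A\<in>\<A>. (T A)\<^sup>2) - (card I)\<^sup>2 / card \<A>"
    using N by (simp add: t_def power2_eq_square field_simps)
  finally show ?thesis
    using sq by (simp add: t_def)
qed

text \<open>
  Each \<open>Z\<^sub>i\<close> has law \<open>M\<close>, so the empirical mean is unbiased and the quantity inside the
  variance is already centred: its variance is its second moment.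
\<close>
lemma Var_empirical_mean:
  fixes f :: "'a \<Rightarrow> real" and Z :: "nat \<Rightarrow> 'w \<Rightarrow> 'a"
  assumes "prob_space P" and n: "n \<ge> 1"
    and Z: "\<And>i. i \<in> {1..n} \<Longrightarrow> Z i \<in> measurable P M"
    and law: "\<And>i. i \<in> {1..n} \<Longrightarrow> distr P M (Z i) = M"
    and f: "integrable M f"
  shows "Var P (\<lambda>w. 1 / of_nat n * (\<Sum>i=1..n. f (Z i w)) - (\<integral>x. f x \<partial>M))
    = (\<integral>w. (1 / n * (\<Sum>i=1..n. f (Z i w)) - (\<integral>x. f x \<partial>M))\<^sup>2 \<partial>P)"
proof -
  interpret P: prob_space P by fact
  have int: "integrable P (\<lambda>w. f (Z i w))" if "i \<in> {1..n}" for i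
    using integrable_distr[OF Z[OF that], of f] f law[OF that] by simp
  have "(\<integral>w. f (Z i w) \<partial>P) = (\<integral>x. f x \<partial>M)" if "i \<in> {1..n}" for i
    using integral_distr[OF Z[OF that], of f] f law[OF that] by simp
  then have "(\<integral>w. 1 / of_nat n * (\<Sum>i=1..n. f (Z i w)) - (\<integral>x. f x \<partial>M) \<partial>P) = 0"
    using int n
    by (subst Bochner_Integration.integral_diff)
      (auto simp: Bochner_Integration.integral_sum P.prob_space
        intro!: integrable_divide Bochner_Integration.integrable_sum)
  then show ?thesis
    unfolding Var_def by simp
qed

text \<open>
  The function is the normalised centred indicator of one of the parts, found by averaging the
  variance over all of them.
\<close>
lemma exists_large_variance:
  fixes M :: "'a measure" and P :: "'w measure" and Z :: "nat \<Rightarrow> 'w \<Rightarrow> 'a"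
  assumes "prob_space M" "prob_space P" and N: "N \<ge> 2" and n: "n \<ge> 1"
    and Z: "\<And>i. i \<in> {1..n} \<Longrightarrow> Z i \<in> measurable P M"
    and law: "\<And>i. i \<in> {1..n} \<Longrightarrow> distr P M (Z i) = M"
    and part: "partition_on (space M) \<A>" and card: "card \<A> = N" and sub: "\<A> \<subseteq> sets M"
    and eq: "\<And>A B. A \<in> \<A> \<Longrightarrow> B \<in> \<A> \<Longrightarrow> measure M A = measure M B"
  obtains f :: "'a \<Rightarrow> real" where "f \<in> L2_space M" "L2_norm M f = 1"
    "Var P (\<lambda>w. 1 / of_nat n * (\<Sum>i=1..n. f (Z i w)) - (\<integral>x. f x \<partial>M))
      \<ge> 1 / real n * (1 - (real n - 1) / (real N - 1))"
proof -
  interpret M: prob_space M by fact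
  interpret P: prob_space P by fact
  have fin: "finite \<A>"
    using card N card.infinite by fastforce
  have ne: "\<A> \<noteq> {}"
    using card N by auto
  have prob: "measure M A = 1 / N" if "A \<in> \<A>" for A
    using M.prob_part_equal[OF part fin sub eq that] card by simp
  \<comment> \<open>The norm of the centred indicator of a part is \<open>sqrt (N - 1) / N\<close>.\<close>
  define c where "c = N / sqrt (real N - 1)"
  define g :: "'a set \<Rightarrow> 'a \<Rightarrow> real" where "g A x = c * (indicat_real A x - 1 / N)" for A x
  have c2: "c\<^sup>2 = N\<^sup>2 / (real N - 1)"
    using N by (simp add: c_def power_divide)
  have g_int: "integrable M (g A)" if "A \<in> \<A>" for A
    using that sub unfolding g_def
    by (intro Bochner_Integration.integrable_diff integrable_mult_right M.integrable_const)
      (auto simp: less_top[symmetric])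
  have g_mean: "(\<integral>x. g A x \<partial>M) = 0" if A: "A \<in> \<A>" for A
  proof -
    have "(\<integral>x. indicat_real A x - 1 / N \<partial>M) = 0"
      using A sub prob[OF A] by (subst Bochner_Integration.integral_diff)
        (auto simp: M.prob_space less_top[symmetric])
    then show ?thesis
      by (simp add: g_def)
  qed
  have g_sq: "integrable M (\<lambda>x. (g A x)\<^sup>2)" "(\<integral>x. (g A x)\<^sup>2 \<partial>M) = 1" if A: "A \<in> \<A>" for A
  proof -
    have *: "(g A x)\<^sup>2 = c\<^sup>2 * (1 - 2 / N) * indicat_real A x + c\<^sup>2 / N\<^sup>2" for x
      by (cases "x \<in> A") (auto simp: g_def power2_eq_square algebra_simps)
    have ind: "integrable M (indicat_real A)"
      using A sub by (auto simp: less_top[symmetric])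
    then show "integrable M (\<lambda>x. (g A x)\<^sup>2)"
      unfolding * by simp
    have "(\<integral>x. (g A x)\<^sup>2 \<partial>M) = c\<^sup>2 * (1 - 2 / N) * measure M A + c\<^sup>2 / N\<^sup>2"
      unfolding * using ind A sub
      by (subst Bochner_Integration.integral_add) (auto simp: M.prob_space)
    also have "\<dots> = c\<^sup>2 * ((real N - 1) / N\<^sup>2)"
      using N by (simp add: prob[OF A] field_simps power2_eq_square)
    also have "\<dots> = 1"
      using N by (simp add: c2)
    finally show "(\<integral>x. (g A x)\<^sup>2 \<partial>M) = 1" .
  qed
  define b where "b = 1 / real n * (1 - (real n - 1) / (real N - 1))"
  define S :: "'a set \<Rightarrow> 'w \<Rightarrow> real" where "S A w = (1 / n * (\<Sum>i=1..n. g A (Z i w)))\<^sup>2" for A w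
  have S_int: "integrable P (S A)" if A: "A \<in> \<A>" for A
  proof (rule P.integrable_const_bound[where B = "c\<^sup>2"])
    have "g A \<in> borel_measurable M"
      using g_int[OF A] by simp
    then show "S A \<in> borel_measurable P"
      unfolding S_def using Z by measurable
    have c0: "c \<ge> 0"
      using N by (simp add: c_def)
    have "\<bar>g A x\<bar> \<le> c" for x
    proof -
      have "\<bar>indicat_real A x - 1 / N\<bar> \<le> 1"
        using N by (auto simp: indicator_def abs_if field_simps)
      then show ?thesis
        using c0 by (simp add: g_def abs_mult mult_left_le)
    qed
    then have "\<bar>\<Sum>i=1..n. g A (Z i w)\<bar> \<le> n * c" for w
      using order_trans[OF sum_abs sum_bounded_above[of "{1..n}" "\<lambda>i. \<bar>g A (Z i w)\<bar>" c]] by simp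
    then have "\<bar>1 / n * (\<Sum>i=1..n. g A (Z i w))\<bar> \<le> c" for w
      using n by (simp add: abs_mult field_simps)
    then show "AE w in P. norm (S A w) \<le> c\<^sup>2"
      unfolding S_def using c0 by (auto simp: abs_le_square_iff[symmetric])
  qed
  have pointwise: "(\<Sum>A\<in>\<A>. S A w) \<ge> N * b" if w: "w \<in> space P" for w
  proof -
    define T where "T A = (\<Sum>i=1..n. indicat_real A (Z i w))" for A
    have "S A w = (c / n)\<^sup>2 * (T A - n / N)\<^sup>2" for A
    proof -
      have "(\<Sum>i=1..n. g A (Z i w)) = c * (T A - n / N)"
        by (simp add: g_def T_def sum_subtractf flip: sum_distrib_left)
      then show ?thesis
        by (simp add: S_def power_divide power_mult_distrib)
    qed
    then have "(\<Sum>A\<in>\<A>. S A w) = (c / n)\<^sup>2 * (\<Sum>A\<in>\<A>. (T A - n / N)\<^sup>2)"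
      by (simp add: sum_distrib_left)
    also have "\<dots> \<ge> (c / n)\<^sup>2 * (n - n\<^sup>2 / N)"
    proof (intro mult_left_mono)
      have "Z i w \<in> space M" if "i \<in> {1..n}" for i
        using measurable_space[OF Z[OF that] w] .
      then show "n - n\<^sup>2 / N \<le> (\<Sum>A\<in>\<A>. (T A - n / N)\<^sup>2)"
        using sum_counts_deviation_ge[OF part fin _ ne, of "{1..n}" "\<lambda>i. Z i w"]
        by (simp add: T_def card)
    qed simp
    moreover have "(c / n)\<^sup>2 * (n - n\<^sup>2 / N) = N * b"
    proof -
      have "(c / n)\<^sup>2 * (n - n\<^sup>2 / N) = c\<^sup>2 * ((real N - n) / (n * N))"
        using N n by (simp add: field_simps power2_eq_square)
      also have "\<dots> = N * ((real N - n) / (n * (real N - 1)))"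
        using N unfolding c2 by (simp add: power2_eq_square)
      also have "(real N - n) / (n * (real N - 1)) = b"
        using N n by (simp add: b_def field_simps)
      finally show ?thesis .
    qed
    ultimately show ?thesis by simp
  qed
  have "(\<Sum>A\<in>\<A>. b) = (\<integral>w. N * b \<partial>P)"
    by (simp add: P.prob_space card)
  also have "\<dots> \<le> (\<integral>w. (\<Sum>A\<in>\<A>. S A w) \<partial>P)"
    using S_int pointwise by (intro integral_mono) auto
  also have "\<dots> = (\<Sum>A\<in>\<A>. \<integral>w. S A w \<partial>P)"
    using S_int by (simp add: Bochner_Integration.integral_sum)
  finally obtain A where A: "A \<in> \<A>" "b \<le> (\<integral>w. S A w \<partial>P)"
    using fin ne by (metis not_le sum_strict_mono)
  show thesis
  proof
    show "g A \<in> L2_space M" "L2_norm M (g A) = 1"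
      using g_sq g_int A(1) by (auto simp: L2_space_def L2_norm_def)
    show "Var P (\<lambda>w. 1 / of_nat n * (\<Sum>i=1..n. g A (Z i w)) - (\<integral>x. g A x \<partial>M))
        \<ge> 1 / real n * (1 - (real n - 1) / (real N - 1))"
      using A Var_empirical_mean[OF \<open>prob_space P\<close> n Z law g_int]
      by (simp add: g_mean S_def b_def)
  qed
qed

lemma Var_of_real:
  fixes Y :: "'w \<Rightarrow> real"
  shows "Var P (\<lambda>w. complex_of_real (Y w)) = Var P Y"
  unfolding Var_def integral_complex_of_real
  by (simp only: norm_of_real real_norm_def flip: of_real_diff)

theorem mainTheorem1:
  fixes M :: "'a measure" and P :: "'w measure"
    and N n :: nat and Z :: "nat \<Rightarrow> 'w \<Rightarrow> 'a"
  assumes "prob_space M" and "prob_space P"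
    and "N \<ge> 2" and "n \<ge> 1"
    and "\<And>i. i \<in> {1..n} \<Longrightarrow> Z i \<in> measurable P M"
    and "\<And>i. i \<in> {1..n} \<Longrightarrow> distr P M (Z i) = M"
    and "\<exists>\<A>. partition_on (space M) \<A> \<and> card \<A> = N \<and> \<A> \<subseteq> sets M \<and>
           (\<forall>A\<in>\<A>. \<forall>B\<in>\<A>. measure M A = measure M B)"
  shows "(SUP f \<in> {f :: 'a \<Rightarrow> real. f \<in> L2_space M \<and> L2_norm M f = 1}.
            ereal (Var P (\<lambda>w. 1 / of_nat n * (\<Sum>i=1..n. f (Z i w)) - (\<integral>x. f x \<partial>M))))
           \<ge> ereal (1 / real n * (1 - (real n - 1) / (real N - 1)))
       \<and> (SUP f \<in> {f :: 'a \<Rightarrow> complex. f \<in> L2_space M \<and> L2_norm M f = 1}.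
            ereal (Var P (\<lambda>w. 1 / of_nat n * (\<Sum>i=1..n. f (Z i w)) - (\<integral>x. f x \<partial>M))))
           \<ge> ereal (1 / real n * (1 - (real n - 1) / (real N - 1)))"
proof -
  obtain \<A> where \<A>: "partition_on (space M) \<A>" "card \<A> = N" "\<A> \<subseteq> sets M"
    "\<And>A B. A \<in> \<A> \<Longrightarrow> B \<in> \<A> \<Longrightarrow> measure M A = measure M B"
    using assms(7) by blast
  obtain f :: "'a \<Rightarrow> real" where f: "f \<in> L2_space M" "L2_norm M f = 1"
    "Var P (\<lambda>w. 1 / of_nat n * (\<Sum>i=1..n. f (Z i w)) - (\<integral>x. f x \<partial>M))
      \<ge> 1 / real n * (1 - (real n - 1) / (real N - 1))"
    by (rule exists_large_variance[OF assms(1-6) \<A>])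
  define h where "h x = complex_of_real (f x)" for x
  have h: "h \<in> L2_space M" "L2_norm M h = 1"
    using f by (auto simp: L2_space_def L2_norm_def h_def[abs_def])
  have "(\<lambda>w. 1 / of_nat n * (\<Sum>i=1..n. h (Z i w)) - (\<integral>x. h x \<partial>M))
      = (\<lambda>w. complex_of_real (1 / of_nat n * (\<Sum>i=1..n. f (Z i w)) - (\<integral>x. f x \<partial>M)))"
    by (simp add: h_def fun_eq_iff)
  then have hV: "Var P (\<lambda>w. 1 / of_nat n * (\<Sum>i=1..n. h (Z i w)) - (\<integral>x. h x \<partial>M))
      \<ge> 1 / real n * (1 - (real n - 1) / (real N - 1))"
    using f(3) by (simp only: Var_of_real)
  show ?thesis
    by (intro conjI SUP_upper2[of f] SUP_upper2[of h] CollectI f(1,2) h, unfold ereal_less_eq)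
      (fact f(3) hV)+
qed

end
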